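(* Let $\alpha\ge0$ be real and let $d,k,\gamma,T_\infty>0$ be fixed. As $h_0\to+\infty$, problem (P1) (convective condition with coefficient $h_0$) converges to problem (P4) (temperature condition $T_\infty t^{\alpha/2}$ at $x=0$), in the sense that, with the solutions $(\Psi_{h_0},s_{h_0},\nu_{h_0})$ and $(\Psi_\infty,s_\infty,\nu_\infty)$ given in the context, $$\lim_{h_0\to+\infty}\nu_{h_0}=\nu_\infty,$$ $$\lim_{h_0\to+\infty}s_{h_0}(t)=s_\infty(t)\quad\text{for all }t>0,$$ $$\lim_{h_0\to+\infty}\Psi_{h_0}(x,t)=\Psi_\infty(x,t)\quad\text{for all }t>0,\ x>0.$$
   Context: $M(a,b,z)$ is the Kummer function $M(a,b,z)=\sum_{j=0}^{\infty}\frac{(a)_j}{(b)_j\,j!}z^j$, where $(a)_0=1$ and $(a)_j=a(a+1)\cdots(a+j-1)$. Throughout $\eta=x/(2\sqrt{dt})$. Problem (P1), for $h_0>0$: find $\Psi(x,t)$ and $s(t)$ with $\Psi_t=d\Psi_{xx}$ for $0<x<s(t)$, $t>0$; $s(0)=0$; and, for $t>0$, $\Psi(s(t),t)=0$, $k\Psi_x(0,t)=h_0t^{-1/2}[\Psi(0,t)-T_\infty t^{\alpha/2}]$, $k\Psi_x(s(t),t)=-\gamma s(t)^\alpha\dot s(t)$. Its (similarity) solution, with dependence on $h_0$ displayed, is $$\Psi_{h_0}(x,t)=t^{\alpha/2}\left[c_{11}(h_0)M\left(-\tfrac{\alpha}{2},\tfrac12,-\eta^2\right)+c_{21}(h_0)\,\eta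 M\left(-\tfrac{\alpha}{2}+\tfrac12,\tfrac32,-\eta^2\right)\right],\quad s_{h_0}(t)=2\nu_{h_0}\sqrt{dt},$$ $$c_{11}(h_0)=\frac{-\nu_{h_0}M\left(-\frac{\alpha}{2}+\frac12,\frac32,-\nu_{h_0}^2\right)}{M\left(-\frac{\alpha}{2},\frac12,-\nu_{h_0}^2\right)}c_{21}(h_0),$$ $$c_{21}(h_0)=\frac{-2h_0\sqrt d\,T_\infty M\left(-\frac{\alpha}{2},\frac12,-\nu_{h_0}^2\right)}{kM\left(-\frac{\alpha}{2},\frac12,-\nu_{h_0}^2\right)+2\sqrt d\,h_0\nu_{h_0}M\left(-\frac{\alpha}{2}+\frac12,\frac32,-\nu_{h_0}^2\right)},$$ where $\nu_{h_0}$ is the unique positive solution of $\frac{h_0T_\infty}{\gamma2^\alpha d^{(\alpha+1)/2}}f_1(x,h_0)=x^{\alpha+1}$, $x>0$, with $f_1(x,h_0)=\left[M\left(\frac{\alpha}{2}+\frac12,\frac12,x^2\right)+2\frac{\sqrt d\,h_0}{k}xM\left(\frac{\alpha}{2}+1,\frac32,x^2\right)\right]^{-1}$. Problem (P4): find $\Psi_\infty(x,t)$ and $s_\infty(t)$ with $(\Psi_\infty)_t=d(\Psi_\infty)_{xx}$ for $0<x<s_\infty(t)$, $t>0$; $s_\infty(0)=0$; and, for $t>0$, $\Psi_\infty(s_\infty(t),t)=0$, $\Psi_\infty(0,t)=T_\infty t^{\alpha/2}$, $k(\Psi_\infty)_x(s_\infty(t),t)=-\gamma s_\infty(t)^\alpha\dot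 s_\infty(t)$. Its (similarity) solution is $$\Psi_\infty(x,t)=t^{\alpha/2}\left[c_{11,\infty}M\left(-\tfrac{\alpha}{2},\tfrac12,-\eta^2\right)+c_{21,\infty}\,\eta M\left(-\tfrac{\alpha}{2}+\tfrac12,\tfrac32,-\eta^2\right)\right],\quad s_\infty(t)=2\nu_\infty\sqrt{dt},$$ $$c_{11,\infty}=T_\infty,\qquad c_{21,\infty}=\frac{-T_\infty M\left(-\frac{\alpha}{2},\frac12,-\nu_\infty^2\right)}{\nu_\infty M\left(-\frac{\alpha}{2}+\frac12,\frac32,-\nu_\infty^2\right)},$$ where $\nu_\infty$ is the unique positive solution of $\frac{kT_\infty}{2^{\alpha+1}d^{\alpha/2+1}\gamma}f_2(x)=x^{\alpha+1}$, $x>0$, with $f_2(x)=\left[xM\left(\frac{\alpha}{2}+1,\frac32,x^2\right)\right]^{-1}$. In the last limit, $\Psi_{h_0}$ and $\Psi_\infty$ are understood as the functions given by these explicit formulas for all $x>0$, $t>0$. *)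

theory Defs
  imports Complex_Main
begin

definition kummerM :: "real \<Rightarrow> real \<Rightarrow> real \<Rightarrow> real" where
  "kummerM a b z = (\<Sum>j. pochhammer a j / (pochhammer b j * fact j) * z ^ j)"

definition similarity_var :: "real \<Rightarrow> real \<Rightarrow> real \<Rightarrow> real" where
  "similarity_var d x t = x / (2 * sqrt (d * t))"

text \<open>
  Similarity solution of the one-phase Stefan problem with convective condition of coefficient
  \<open>h0\<close> at \<open>x = 0\<close>,
    \<open>\<Psi>\<^sub>t = d \<Psi>\<^sub>x\<^sub>x\<close> for \<open>0 < x < s(t)\<close>, \<open>s(0) = 0\<close>, \<open>\<Psi>(s(t),t) = 0\<close>,
    \<open>k \<Psi>\<^sub>x(0,t) = h0 t^(-1/2) (\<Psi>(0,t) - T t^(\<alpha>/2))\<close>,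
    \<open>k \<Psi>\<^sub>x(s(t),t) = -\<gamma> s(t)^\<alpha> s'(t)\<close>.
  Real powers are rendered by \<open>powr\<close>; all their bases are positive in the intended range
  \<open>d, k, \<gamma>, T, h0, x, t > 0\<close>.
\<close>

definition conv_f1 :: "real \<Rightarrow> real \<Rightarrow> real \<Rightarrow> real \<Rightarrow> real \<Rightarrow> real" where
  "conv_f1 \<alpha> d k x h0 =
     inverse (kummerM (\<alpha>/2 + 1/2) (1/2) (x\<^sup>2)
              + 2 * (sqrt d * h0 / k) * x * kummerM (\<alpha>/2 + 1) (3/2) (x\<^sup>2))"

definition conv_nu :: "real \<Rightarrow> real \<Rightarrow> real \<Rightarrow> real \<Rightarrow> real \<Rightarrow> real \<Rightarrow> real" where
  "conv_nu \<alpha> d k \<gamma> T h0 =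
     (THE x. x > 0 \<and>
        h0 * T / (\<gamma> * 2 powr \<alpha> * d powr ((\<alpha> + 1) / 2)) * conv_f1 \<alpha> d k x h0 = x powr (\<alpha> + 1))"

definition conv_s :: "real \<Rightarrow> real \<Rightarrow> real \<Rightarrow> real \<Rightarrow> real \<Rightarrow> real \<Rightarrow> real \<Rightarrow> real" where
  "conv_s \<alpha> d k \<gamma> T h0 t = 2 * conv_nu \<alpha> d k \<gamma> T h0 * sqrt (d * t)"

definition conv_c21 :: "real \<Rightarrow> real \<Rightarrow> real \<Rightarrow> real \<Rightarrow> real \<Rightarrow> real \<Rightarrow> real" where
  "conv_c21 \<alpha> d k \<gamma> T h0 =
     (let \<nu> = conv_nu \<alpha> d k \<gamma> T h0 in
       - 2 * h0 * sqrt d * T * kummerM (- \<alpha>/2) (1/2) (- (\<nu>\<^sup>2)) /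
       (k * kummerM (- \<alpha>/2) (1/2) (- (\<nu>\<^sup>2))
        + 2 * sqrt d * h0 * \<nu> * kummerM (- \<alpha>/2 + 1/2) (3/2) (- (\<nu>\<^sup>2))))"

definition conv_c11 :: "real \<Rightarrow> real \<Rightarrow> real \<Rightarrow> real \<Rightarrow> real \<Rightarrow> real \<Rightarrow> real" where
  "conv_c11 \<alpha> d k \<gamma> T h0 =
     (let \<nu> = conv_nu \<alpha> d k \<gamma> T h0 in
       - \<nu> * kummerM (- \<alpha>/2 + 1/2) (3/2) (- (\<nu>\<^sup>2)) / kummerM (- \<alpha>/2) (1/2) (- (\<nu>\<^sup>2))
       * conv_c21 \<alpha> d k \<gamma> T h0)"

definition conv_Psi :: "real \<Rightarrow> real \<Rightarrow> real \<Rightarrow> real \<Rightarrow> real \<Rightarrow> real \<Rightarrow> real \<Rightarrow> real \<Rightarrow> real" where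
  "conv_Psi \<alpha> d k \<gamma> T h0 x t =
     (let \<eta> = similarity_var d x t in
       t powr (\<alpha>/2) *
       (conv_c11 \<alpha> d k \<gamma> T h0 * kummerM (- \<alpha>/2) (1/2) (- (\<eta>\<^sup>2))
        + conv_c21 \<alpha> d k \<gamma> T h0 * \<eta> * kummerM (- \<alpha>/2 + 1/2) (3/2) (- (\<eta>\<^sup>2))))"

text \<open>
  Similarity solution of the same problem with the convective condition replaced by the
  temperature condition \<open>\<Psi>(0,t) = T t^(\<alpha>/2)\<close>.
\<close>

definition temp_f2 :: "real \<Rightarrow> real \<Rightarrow> real" where
  "temp_f2 \<alpha> x = inverse (x * kummerM (\<alpha>/2 + 1) (3/2) (x\<^sup>2))"

definition temp_nu :: "real \<Rightarrow> real \<Rightarrow> real \<Rightarrow> real \<Rightarrow> real \<Rightarrow> real" where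
  "temp_nu \<alpha> d k \<gamma> T =
     (THE x. x > 0 \<and>
        k * T / (2 powr (\<alpha> + 1) * d powr (\<alpha>/2 + 1) * \<gamma>) * temp_f2 \<alpha> x = x powr (\<alpha> + 1))"

definition temp_s :: "real \<Rightarrow> real \<Rightarrow> real \<Rightarrow> real \<Rightarrow> real \<Rightarrow> real \<Rightarrow> real" where
  "temp_s \<alpha> d k \<gamma> T t = 2 * temp_nu \<alpha> d k \<gamma> T * sqrt (d * t)"

definition temp_c11 :: "real \<Rightarrow> real" where
  "temp_c11 T = T"

definition temp_c21 :: "real \<Rightarrow> real \<Rightarrow> real \<Rightarrow> real \<Rightarrow> real \<Rightarrow> real" where
  "temp_c21 \<alpha> d k \<gamma> T =
     (let \<nu> = temp_nu \<alpha> d k \<gamma> T in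
       - T * kummerM (- \<alpha>/2) (1/2) (- (\<nu>\<^sup>2)) /
       (\<nu> * kummerM (- \<alpha>/2 + 1/2) (3/2) (- (\<nu>\<^sup>2))))"

definition temp_Psi :: "real \<Rightarrow> real \<Rightarrow> real \<Rightarrow> real \<Rightarrow> real \<Rightarrow> real \<Rightarrow> real \<Rightarrow> real" where
  "temp_Psi \<alpha> d k \<gamma> T x t =
     (let \<eta> = similarity_var d x t in
       t powr (\<alpha>/2) *
       (temp_c11 T * kummerM (- \<alpha>/2) (1/2) (- (\<eta>\<^sup>2))
        + temp_c21 \<alpha> d k \<gamma> T * \<eta> * kummerM (- \<alpha>/2 + 1/2) (3/2) (- (\<eta>\<^sup>2))))"

end

theory Submission
  imports Defs "HOL-Computational_Algebra.Formal_Power_Series"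
begin

text \<open>
  After division by \<open>h0\<close>, the equation for \<open>\<nu>\<close> in the convective problem reads
  \<open>x powr (\<alpha>+1) * (A(x\<^sup>2) / h0 + (2 sqrt d / k) * x * B(x\<^sup>2)) = c\<close>, where
  \<open>A = M(\<alpha>/2 + 1/2, 1/2, \<cdot>)\<close> and \<open>B = M(\<alpha>/2 + 1, 3/2, \<cdot>)\<close>, and the constant
  \<open>c = T / (\<gamma> 2\<^sup>\<alpha> d powr ((\<alpha>+1)/2))\<close> is free of \<open>h0\<close>. The equation of the temperature problem is
  the same one with \<open>1 / h0\<close> replaced by \<open>0\<close>, so the temperature problem is literally the value
  at \<open>\<epsilon> = 0\<close> of a family indexed by \<open>\<epsilon> = 1 / h0\<close> (\<open>conv_equation_iff\<close>, \<open>temp_equation_iff\<close>).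

  The parameters of \<open>A\<close> and \<open>B\<close> are positive, hence all coefficients of these series are
  nonnegative, \<open>A\<close> and \<open>B\<close> are increasing and at least \<open>1\<close> on \<open>[0,\<infinity>)\<close>, and each member of the
  family increases strictly from \<open>0\<close> to \<open>\<infinity>\<close>. Therefore each equation has exactly one positive
  root (\<open>stefan_fun_unique_root\<close>). For strictly increasing functions, pointwise
  convergence already forces the roots to converge (\<open>tendsto_root_of_strict_mono\<close>), which gives
  the limit of \<open>\<nu>\<close> and, up to a constant factor, of \<open>s\<close>.

  The limit of the temperature then follows by continuity of \<open>M\<close>, provided the quotients that
  define the coefficients do not degenerate: \<open>M(-\<alpha>/2, 1/2, -\<nu>\<^sup>2)\<close> and
  \<open>M(-\<alpha>/2 + 1/2, 3/2, -\<nu>\<^sup>2)\<close> must not vanish. Their series may have terms of both signs, so this is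
  invisible term by term; Kummer's transformation \<open>M(a,b,-z) = exp(-z) M(b-a,b,z)\<close> rewrites
  them as positive multiples of \<open>A\<close> and \<open>B\<close>.
\<close>

section \<open>The Kummer series\<close>

definition kummer_coeff :: "real \<Rightarrow> real \<Rightarrow> nat \<Rightarrow> real" where
  "kummer_coeff a b j = pochhammer a j / (pochhammer b j * fact j)"

lemma kummerM_eq_suminf_coeff: "kummerM a b z = (\<Sum>j. kummer_coeff a b j * z ^ j)"
  by (simp add: kummerM_def kummer_coeff_def)

lemma kummer_coeff_Suc:
  "kummer_coeff a b (Suc j) = kummer_coeff a b j * ((a + j) / ((b + j) * (1 + j)))"
  by (simp add: kummer_coeff_def pochhammer_Suc)

lemma kummer_coeff_nonneg:
  assumes "a > 0" "b > 0"
  shows "kummer_coeff a b j \<ge> 0"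
  using pochhammer_pos[OF assms(1), of j] pochhammer_pos[OF assms(2), of j]
  by (simp add: kummer_coeff_def)

text \<open>
  The ratio of consecutive terms is at most \<open>K \<bar>z\<bar> / (n + 1)\<close> with \<open>K\<close> a bound of
  \<open>\<bar>a + n\<bar> / (b + n)\<close> uniform in \<open>n\<close>, so the series converges absolutely on the whole line.
\<close>
lemma summable_norm_kummer:
  assumes b: "b > 0"
  shows "summable (\<lambda>j. norm (kummer_coeff a b j * z ^ j))"
proof -
  define K where "K = \<bar>a\<bar> / b + 1"
  have K: "K > 0" using b by (simp add: K_def add_nonneg_pos)
  show ?thesis
  proof (rule summable_ratio_test[where c = "1/2" and N = "nat \<lceil>2 * K * \<bar>z\<bar>\<rceil>"])
    fix n :: nat
    assume "n \<ge> nat \<lceil>2 * K * \<bar>z\<bar>\<rceil>"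
    then have n: "2 * K * \<bar>z\<bar> \<le> real n" by linarith
    have "\<bar>a + n\<bar> \<le> K * (b + n)"
    proof -
      have "\<bar>a + n\<bar> \<le> \<bar>a\<bar> + n" by linarith
      also have "\<dots> \<le> \<bar>a\<bar> + n + (\<bar>a\<bar> / b * n + b)" using b by simp
      also have "\<dots> = K * (b + n)" using b by (simp add: K_def field_simps)
      finally show ?thesis .
    qed
    then have "\<bar>a + n\<bar> / (b + n) \<le> K" using b by (simp add: field_simps)
    then have "\<bar>a + n\<bar> / (b + n) * (\<bar>z\<bar> / (1 + n)) \<le> K * (\<bar>z\<bar> / (1 + n))"
      by (intro mult_right_mono) auto
    also have "\<dots> \<le> 1/2" using n by (simp add: field_simps)
    finally have r: "\<bar>a + n\<bar> / (b + n) * (\<bar>z\<bar> / (1 + n)) \<le> 1/2" .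
    have "norm (norm (kummer_coeff a b (Suc n) * z ^ Suc n))
        = (\<bar>a + n\<bar> / (b + n) * (\<bar>z\<bar> / (1 + n))) * norm (norm (kummer_coeff a b n * z ^ n))"
      using b by (simp add: kummer_coeff_Suc abs_mult)
    also have "\<dots> \<le> 1/2 * norm (norm (kummer_coeff a b n * z ^ n))"
      using r by (intro mult_right_mono) auto
    finally show "norm (norm (kummer_coeff a b (Suc n) * z ^ Suc n))
        \<le> 1/2 * norm (norm (kummer_coeff a b n * z ^ n))" .
  qed simp
qed

lemma summable_kummer: "b > 0 \<Longrightarrow> summable (\<lambda>j. kummer_coeff a b j * z ^ j)"
  by (rule summable_norm_cancel) (rule summable_norm_kummer)

lemma isCont_kummerM: "b > 0 \<Longrightarrow> isCont (kummerM a b) z"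
  unfolding kummerM_eq_suminf_coeff[abs_def]
  by (rule isCont_powser_converges_everywhere) (rule summable_kummer)

lemma continuous_on_kummerM [continuous_intros]:
  assumes "b > 0" "continuous_on S f"
  shows "continuous_on S (\<lambda>x. kummerM a b (f x))"
  by (rule continuous_on_compose2[of UNIV "kummerM a b"])
     (auto simp: assms continuous_on_eq_continuous_at isCont_kummerM)

lemma kummerM_mono:
  assumes "a > 0" "b > 0" "0 \<le> z" "z \<le> w"
  shows "kummerM a b z \<le> kummerM a b w"
  unfolding kummerM_eq_suminf_coeff using assms
  by (intro suminf_le summable_kummer mult_left_mono power_mono kummer_coeff_nonneg)

lemma kummerM_0: "kummerM a b 0 = 1"
  unfolding kummerM_eq_suminf_coeff using powser_zero[of "kummer_coeff a b"]
  by (simp add: kummer_coeff_def)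

lemma kummerM_ge_1: "a > 0 \<Longrightarrow> b > 0 \<Longrightarrow> 0 \<le> z \<Longrightarrow> kummerM a b z \<ge> 1"
  using kummerM_mono[of a b 0 z] by (simp add: kummerM_0)

lemma pochhammer_neg_of_nat:
  assumes "k \<le> n"
  shows "pochhammer (- real n) k = (-1) ^ k * fact n / fact (n - k)"
proof -
  have "(-1) ^ k * pochhammer (- real n) k / fact k = real (n choose k)"
    by (simp add: binomial_gbinomial gbinomial_pochhammer)
  also have "\<dots> = fact n / (fact k * fact (n - k))"
    using assms by (rule binomial_fact)
  finally have "(-1) ^ k * pochhammer (- real n) k = fact n / fact (n - k)"
    by (simp add: field_simps)
  then have "(-1) ^ k * ((-1) ^ k * pochhammer (- real n) k) = (-1) ^ k * (fact n / fact (n - k))"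
    by simp
  then show ?thesis by (simp flip: mult.assoc power_add power_mult_distrib)
qed

text \<open>
  Both sides of \<open>M(a,b,-z) exp z = M(b-a,b,z)\<close> are power series in \<open>z\<close>. The coefficient of
  \<open>z\<^sup>n\<close> in the Cauchy product on the left becomes, once \<open>n! / (n-j)!\<close> is written as a Pochhammer
  symbol of \<open>-n\<close>, the Chu--Vandermonde sum for a terminating Gauss series at \<open>1\<close>, whose value is
  \<open>(b-a)\<^sub>n / (b)\<^sub>n\<close>.
\<close>
theorem kummer_transformation:
  assumes b: "b > 0"
  shows "kummerM a b (- z) = exp (- z) * kummerM (b - a) b z"
proof -
  have coeff: "(\<Sum>j\<le>n. kummer_coeff a b j * (- z) ^ j * (inverse (fact (n - j)) * z ^ (n - j)))
      = kummer_coeff (b - a) b n * z ^ n" for n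
  proof -
    have "(\<Sum>j\<le>n. kummer_coeff a b j * (- z) ^ j * (inverse (fact (n - j)) * z ^ (n - j)))
        = (\<Sum>j\<le>n. z ^ n / fact n * ((pochhammer a j * pochhammer (- real n) j) /
            (fact j * pochhammer b j)))"
    proof (rule sum.cong[OF refl])
      fix j assume "j \<in> {..n}"
      then have j: "j \<le> n" by simp
      have "z ^ n = z ^ j * z ^ (n - j)" using j by (simp flip: power_add)
      then show "kummer_coeff a b j * (- z) ^ j * (inverse (fact (n - j)) * z ^ (n - j))
        = z ^ n / fact n * ((pochhammer a j * pochhammer (- real n) j) /
            (fact j * pochhammer b j))"
        by (simp add: pochhammer_neg_of_nat[OF j] kummer_coeff_def power_minus[of z] field_simps)
    qed
    also have "\<dots> = z ^ n / fact n * (pochhammer (b - a) n / pochhammer b n)"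
      using Vandermonde_pochhammer[of n b a] b
      by (subst sum_distrib_left[symmetric]) (simp add: atMost_atLeast0)
    finally show ?thesis by (simp add: kummer_coeff_def field_simps)
  qed
  have "(\<Sum>j. kummer_coeff a b j * (- z) ^ j) * (\<Sum>j. inverse (fact j) * z ^ j)
      = (\<Sum>n. \<Sum>j\<le>n. kummer_coeff a b j * (- z) ^ j * (inverse (fact (n - j)) * z ^ (n - j)))"
    using summable_norm_kummer[OF b] summable_norm_exp[of z]
    by (intro Cauchy_product) (simp_all add: field_simps)
  then have "kummerM a b (- z) * exp z = kummerM (b - a) b z"
    by (simp add: coeff kummerM_eq_suminf_coeff exp_def)
  then show ?thesis by (simp add: exp_minus field_simps)
qed

text \<open>
  The transformation trades the negative argument for the positive parameter \<open>b - a\<close>, and then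
  all terms of the series are nonnegative.
\<close>
lemma kummerM_neg_pos:
  assumes "b > 0" "a < b" "0 \<le> z"
  shows "kummerM a b (- z) > 0"
  using kummerM_ge_1[of "b - a" b z] assms by (simp add: kummer_transformation)

section \<open>Roots of increasing functions\<close>

lemma strict_mono_unique_root:
  fixes g :: "real \<Rightarrow> real"
  assumes mono: "strict_mono_on {0..} g" and cont: "continuous_on {0..} g"
    and "g 0 < c" "b > 0" "c \<le> g b"
  shows "\<exists>!x. x > 0 \<and> g x = c"
proof -
  obtain x where x: "0 \<le> x" "g x = c"
    using IVT'[of g 0 c b] assms continuous_on_subset[OF cont, of "{0..b}"] by auto
  with \<open>g 0 < c\<close> have "x > 0" by (cases "x = 0") auto
  moreover have "y = x" if "y > 0" "g y = c" for y
    using strict_mono_on_eqD[OF mono, of y x] that x by auto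
  ultimately show ?thesis using x by blast
qed

text \<open>
  Just to the right of \<open>r\<^sub>0\<close> the limit function exceeds \<open>c\<close>, hence so does \<open>g i\<close> for late \<open>i\<close>, and
  monotonicity of \<open>g i\<close> puts its root to the left of that point; symmetrically on the other
  side. Each comparison uses a single point, so pointwise convergence suffices.
\<close>
lemma tendsto_root_of_strict_mono:
  fixes g :: "'a \<Rightarrow> real \<Rightarrow> real"
  assumes lim: "\<And>x. x > 0 \<Longrightarrow> ((\<lambda>i. g i x) \<longlongrightarrow> g\<^sub>0 x) F"
    and mono: "\<forall>\<^sub>F i in F. strict_mono_on {0..} (g i)"
    and root: "\<forall>\<^sub>F i in F. r i > 0 \<and> g i (r i) = c"
    and mono0: "strict_mono_on {0..} g\<^sub>0"
    and root0: "r\<^sub>0 > 0" "g\<^sub>0 r\<^sub>0 = c"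
  shows "(r \<longlongrightarrow> r\<^sub>0) F"
proof (rule order_tendstoI)
  fix u assume u: "r\<^sub>0 < u"
  have "c < g\<^sub>0 u" using strict_mono_onD[OF mono0 _ _ u] root0 u by auto
  with u root0 have "\<forall>\<^sub>F i in F. c < g i u" by (intro order_tendstoD(1)[OF lim]) auto
  with mono root show "\<forall>\<^sub>F i in F. r i < u"
  proof eventually_elim
    case (elim i)
    then show ?case
      using strict_mono_on_leD[of "{0..}" "g i" u "r i"] u root0 by force
  qed
next
  fix u assume u: "u < r\<^sub>0"
  \<comment> \<open>The bound \<open>u\<close> may be negative; \<open>v\<close> moves the comparison point into the region \<open>x > 0\<close> where \<open>g i\<close> is
    controlled, still below \<open>r\<^sub>0\<close>.\<close>
  define v where "v = max u (r\<^sub>0 / 2)"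
  have v: "0 < v" "v < r\<^sub>0" "u \<le> v" using u root0 by (auto simp: v_def)
  have "g\<^sub>0 v < c" using strict_mono_onD[OF mono0 _ _ v(2)] root0 v by auto
  with v have "\<forall>\<^sub>F i in F. g i v < c" by (intro order_tendstoD(2)[OF lim]) auto
  with mono root show "\<forall>\<^sub>F i in F. u < r i"
  proof eventually_elim
    case (elim i)
    then show ?case
      using strict_mono_on_leD[of "{0..}" "g i" "r i" v] v by force
  qed
qed

section \<open>The free boundary coefficient\<close>

text \<open>
  The Stefan condition with the unknown on one side only. With \<open>q = 2 sqrt d / k\<close>, the value
  \<open>\<epsilon> = 1 / h0\<close> belongs to the convective problem and \<open>\<epsilon> = 0\<close> to the temperature problem, while
  the right-hand side is the same in both.
\<close>
definition stefan_fun :: "real \<Rightarrow> real \<Rightarrow> real \<Rightarrow> real \<Rightarrow> real" where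
  "stefan_fun \<alpha> q \<epsilon> x = x powr (\<alpha> + 1) *
     (\<epsilon> * kummerM (\<alpha>/2 + 1/2) (1/2) (x\<^sup>2) + q * x * kummerM (\<alpha>/2 + 1) (3/2) (x\<^sup>2))"

lemma stefan_fun_strict_mono:
  assumes "\<alpha> \<ge> 0" "q > 0" "\<epsilon> \<ge> 0"
  shows "strict_mono_on {0..} (stefan_fun \<alpha> q \<epsilon>)"
proof (rule strict_mono_onI)
  fix x y :: real
  assume "x \<in> {0..}" "y \<in> {0..}" and xy: "x < y"
  then have x: "0 \<le> x" by simp
  let ?A = "\<lambda>x. kummerM (\<alpha>/2 + 1/2) (1/2) (x\<^sup>2)" and ?B = "\<lambda>x. kummerM (\<alpha>/2 + 1) (3/2) (x\<^sup>2)"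
  have A: "?A x \<le> ?A y" and B: "?B x \<le> ?B y"
    using x xy assms by (intro kummerM_mono; simp add: power_mono)+
  have A1: "?A x \<ge> 1" and B1: "?B x \<ge> 1"
    using assms by (intro kummerM_ge_1; simp)+
  have p: "x powr (\<alpha> + 1) < y powr (\<alpha> + 1)"
    using x xy assms by (intro powr_less_mono2) auto
  have e: "\<epsilon> * ?A x \<le> \<epsilon> * ?A y" using A assms by (intro mult_left_mono)
  have "q * x * ?B x \<le> q * x * ?B y" using B x assms by (intro mult_left_mono) auto
  also have "\<dots> < q * y * ?B y" using B B1 xy assms by (intro mult_strict_right_mono) auto
  finally have "\<epsilon> * ?A x + q * x * ?B x < \<epsilon> * ?A y + q * y * ?B y" using e by linarith
  moreover have "0 \<le> \<epsilon> * ?A x + q * x * ?B x" using A1 B1 x assms by simp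
  ultimately show "stefan_fun \<alpha> q \<epsilon> x < stefan_fun \<alpha> q \<epsilon> y"
    unfolding stefan_fun_def using p by (intro mult_strict_mono') auto
qed

lemma stefan_fun_unique_root:
  assumes "\<alpha> \<ge> 0" "q > 0" "\<epsilon> \<ge> 0" "c > 0"
  shows "\<exists>!x. x > 0 \<and> stefan_fun \<alpha> q \<epsilon> x = c"
proof (rule strict_mono_unique_root[OF stefan_fun_strict_mono])
  show "continuous_on {0..} (stefan_fun \<alpha> q \<epsilon>)"
    unfolding stefan_fun_def using assms
    by (intro continuous_intros continuous_on_powr') auto
  show "stefan_fun \<alpha> q \<epsilon> 0 < c" using assms by (simp add: stefan_fun_def)
  \<comment> \<open>From \<open>1\<close> on, the power and both Kummer functions are at least \<open>1\<close>, so the function dominates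
    \<open>q * x\<close> there.\<close>
  define b where "b = max 1 (c / q)"
  have b: "b \<ge> 1" "c / q \<le> b" by (auto simp: b_def)
  show "b > 0" using b by simp
  have A1: "kummerM (\<alpha>/2 + 1/2) (1/2) (b\<^sup>2) \<ge> 1" and B1: "kummerM (\<alpha>/2 + 1) (3/2) (b\<^sup>2) \<ge> 1"
    using assms by (intro kummerM_ge_1; simp)+
  have "c \<le> q * b" using b assms by (simp add: field_simps)
  also have "\<dots> \<le> q * b * kummerM (\<alpha>/2 + 1) (3/2) (b\<^sup>2)"
    using mult_left_mono[OF B1, of "q * b"] b assms by simp
  also have "\<dots> \<le> 1 * (\<epsilon> * kummerM (\<alpha>/2 + 1/2) (1/2) (b\<^sup>2) + q * b * kummerM (\<alpha>/2 + 1) (3/2) (b\<^sup>2))"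
    using A1 assms by simp
  also have "\<dots> \<le> stefan_fun \<alpha> q \<epsilon> b"
    unfolding stefan_fun_def using A1 B1 assms b
    by (intro mult_right_mono ge_one_powr_ge_zero) auto
  finally show "c \<le> stefan_fun \<alpha> q \<epsilon> b" .
qed (use assms in auto)

lemma powr_half_plus_one:
  fixes d :: real
  assumes "d > 0"
  shows "d powr (\<alpha>/2 + 1) = d powr ((\<alpha> + 1)/2) * sqrt d"
proof -
  have "\<alpha>/2 + 1 = (\<alpha> + 1)/2 + 1/2" by (simp add: field_simps)
  then show ?thesis using assms by (simp only: powr_add powr_half_sqrt)
qed

lemma conv_equation_iff:
  fixes \<alpha> d k \<gamma> T h x :: real
  assumes "\<alpha> \<ge> 0" "d > 0" "k > 0" "\<gamma> > 0" "h > 0" "x > 0"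
  shows "h * T / (\<gamma> * 2 powr \<alpha> * d powr ((\<alpha> + 1) / 2)) * conv_f1 \<alpha> d k x h = x powr (\<alpha> + 1)
     \<longleftrightarrow> stefan_fun \<alpha> (2 * sqrt d / k) (1 / h) x = T / (\<gamma> * 2 powr \<alpha> * d powr ((\<alpha> + 1) / 2))"
proof -
  define A B P Q where "A = kummerM (\<alpha>/2 + 1/2) (1/2) (x\<^sup>2)"
    and "B = kummerM (\<alpha>/2 + 1) (3/2) (x\<^sup>2)"
    and "P = \<gamma> * 2 powr \<alpha> * d powr ((\<alpha> + 1) / 2)"
    and "Q = x powr (\<alpha> + 1)"
  define D where "D = A + 2 * (sqrt d * h / k) * x * B"
  have "A \<ge> 1" "B \<ge> 1" unfolding A_def B_def using assms by (intro kummerM_ge_1; simp)+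
  then have D: "D > 0" unfolding D_def using assms by (intro add_pos_nonneg) auto
  have P: "P > 0" using assms by (simp add: P_def)
  have f1: "conv_f1 \<alpha> d k x h = inverse D" by (simp add: conv_f1_def A_def B_def D_def)
  have g: "stefan_fun \<alpha> (2 * sqrt d / k) (1 / h) x = Q * D / h"
    using assms by (simp add: stefan_fun_def D_def A_def B_def Q_def field_simps)
  have "h * T / P * inverse D = Q \<longleftrightarrow> Q * D / h = T / P"
    using D P assms by (simp add: field_simps) argo
  then show ?thesis by (simp only: f1 g P_def Q_def)
qed

lemma temp_equation_iff:
  fixes \<alpha> d k \<gamma> T x :: real
  assumes "\<alpha> \<ge> 0" "d > 0" "k > 0" "\<gamma> > 0" "x > 0"
  shows "k * T / (2 powr (\<alpha> + 1) * d powr (\<alpha>/2 + 1) * \<gamma>) * temp_f2 \<alpha> x = x powr (\<alpha> + 1)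
     \<longleftrightarrow> stefan_fun \<alpha> (2 * sqrt d / k) 0 x = T / (\<gamma> * 2 powr \<alpha> * d powr ((\<alpha> + 1) / 2))"
proof -
  define B P Q where "B = kummerM (\<alpha>/2 + 1) (3/2) (x\<^sup>2)"
    and "P = \<gamma> * 2 powr \<alpha> * d powr ((\<alpha> + 1) / 2)"
    and "Q = x powr (\<alpha> + 1)"
  have B: "B \<ge> 1" unfolding B_def using assms by (intro kummerM_ge_1; simp)
  have P: "P > 0" using assms by (simp add: P_def)
  have den: "2 powr (\<alpha> + 1) * d powr (\<alpha>/2 + 1) * \<gamma> = 2 * sqrt d * P"
    unfolding powr_half_plus_one[OF assms(2)] by (simp add: P_def powr_add)
  have f2: "temp_f2 \<alpha> x = inverse (x * B)" by (simp add: temp_f2_def B_def)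
  have g: "stefan_fun \<alpha> (2 * sqrt d / k) 0 x = Q * (2 * sqrt d / k * x * B)"
    by (simp add: stefan_fun_def B_def Q_def)
  have "k * T / (2 * sqrt d * P) * inverse (x * B) = Q \<longleftrightarrow> Q * (2 * sqrt d / k * x * B) = T / P"
    using B P assms by (simp add: field_simps) argo
  then show ?thesis by (simp only: f2 g den P_def Q_def)
qed

lemma conv_nu_root:
  assumes "\<alpha> \<ge> 0" "d > 0" "k > 0" "\<gamma> > 0" "T > 0" "h > 0"
  shows "conv_nu \<alpha> d k \<gamma> T h > 0 \<and>
    stefan_fun \<alpha> (2 * sqrt d / k) (1 / h) (conv_nu \<alpha> d k \<gamma> T h)
      = T / (\<gamma> * 2 powr \<alpha> * d powr ((\<alpha> + 1) / 2))"
proof -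
  have "conv_nu \<alpha> d k \<gamma> T h = (THE x. x > 0 \<and> stefan_fun \<alpha> (2 * sqrt d / k) (1 / h) x
      = T / (\<gamma> * 2 powr \<alpha> * d powr ((\<alpha> + 1) / 2)))"
    unfolding conv_nu_def using conv_equation_iff[of \<alpha> d k \<gamma> h _ T] assms
    by (intro arg_cong[where f = The]) auto
  then show ?thesis
    using theI'[OF stefan_fun_unique_root[of \<alpha> "2 * sqrt d / k" "1 / h"
        "T / (\<gamma> * 2 powr \<alpha> * d powr ((\<alpha> + 1) / 2))"]] assms by simp
qed

lemma temp_nu_root:
  assumes "\<alpha> \<ge> 0" "d > 0" "k > 0" "\<gamma> > 0" "T > 0"
  shows "temp_nu \<alpha> d k \<gamma> T > 0 \<and>
    stefan_fun \<alpha> (2 * sqrt d / k) 0 (temp_nu \<alpha> d k \<gamma> T)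
      = T / (\<gamma> * 2 powr \<alpha> * d powr ((\<alpha> + 1) / 2))"
proof -
  have "temp_nu \<alpha> d k \<gamma> T = (THE x. x > 0 \<and> stefan_fun \<alpha> (2 * sqrt d / k) 0 x
      = T / (\<gamma> * 2 powr \<alpha> * d powr ((\<alpha> + 1) / 2)))"
    unfolding temp_nu_def using temp_equation_iff[of \<alpha> d k \<gamma> _ T] assms
    by (intro arg_cong[where f = The]) auto
  then show ?thesis
    using theI'[OF stefan_fun_unique_root[of \<alpha> "2 * sqrt d / k" 0
        "T / (\<gamma> * 2 powr \<alpha> * d powr ((\<alpha> + 1) / 2))"]] assms by simp
qed

lemma tendsto_inverse_coefficient: "((\<lambda>h::real. 1 / h) \<longlongrightarrow> 0) at_top"
  using tendsto_inverse_0_at_top[OF filterlim_ident] by (simp add: inverse_eq_divide)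

lemma conv_nu_tendsto:
  assumes "\<alpha> \<ge> 0" "d > 0" "k > 0" "\<gamma> > 0" "T > 0"
  shows "(conv_nu \<alpha> d k \<gamma> T \<longlongrightarrow> temp_nu \<alpha> d k \<gamma> T) at_top"
proof (rule tendsto_root_of_strict_mono)
  show "((\<lambda>h. stefan_fun \<alpha> (2 * sqrt d / k) (1 / h) x) \<longlongrightarrow> stefan_fun \<alpha> (2 * sqrt d / k) 0 x) at_top"
    for x
    unfolding stefan_fun_def by (intro tendsto_intros tendsto_inverse_coefficient)
  show "\<forall>\<^sub>F h in at_top. strict_mono_on {0..} (stefan_fun \<alpha> (2 * sqrt d / k) (1 / h))"
    using eventually_gt_at_top[of 0]
    by eventually_elim (use assms in \<open>auto intro!: stefan_fun_strict_mono\<close>)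
  show "\<forall>\<^sub>F h in at_top. conv_nu \<alpha> d k \<gamma> T h > 0 \<and>
      stefan_fun \<alpha> (2 * sqrt d / k) (1 / h) (conv_nu \<alpha> d k \<gamma> T h)
      = T / (\<gamma> * 2 powr \<alpha> * d powr ((\<alpha> + 1) / 2))"
    using eventually_gt_at_top[of 0] by eventually_elim (rule conv_nu_root[OF assms])
  show "strict_mono_on {0..} (stefan_fun \<alpha> (2 * sqrt d / k) 0)"
    using assms by (intro stefan_fun_strict_mono) auto
  show "temp_nu \<alpha> d k \<gamma> T > 0"
    and "stefan_fun \<alpha> (2 * sqrt d / k) 0 (temp_nu \<alpha> d k \<gamma> T)
      = T / (\<gamma> * 2 powr \<alpha> * d powr ((\<alpha> + 1) / 2))"
    using temp_nu_root[OF assms] by auto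
qed

section \<open>The temperature coefficients\<close>

text \<open>
  Dividing numerator and denominator of \<open>c\<^sub>2\<^sub>1\<close> by \<open>h0\<close> leaves a denominator whose limit
  \<open>2 sqrt d \<nu>\<^sub>\<infinity> M(-\<alpha>/2 + 1/2, 3/2, -\<nu>\<^sub>\<infinity>\<^sup>2)\<close> is positive. In \<open>c\<^sub>1\<^sub>1\<close> one also divides by
  \<open>M(-\<alpha>/2, 1/2, -\<nu>\<^sup>2)\<close>; as its limit is positive too, the quotient converges, and substituting
  the limit of \<open>c\<^sub>2\<^sub>1\<close> cancels everything but \<open>T\<close>.
\<close>
lemma conv_c_tendsto:
  assumes "\<alpha> \<ge> 0" "d > 0" "k > 0" "\<gamma> > 0" "T > 0"
  shows conv_c21_tendsto: "(conv_c21 \<alpha> d k \<gamma> T \<longlongrightarrow> temp_c21 \<alpha> d k \<gamma> T) at_top"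
    and conv_c11_tendsto: "(conv_c11 \<alpha> d k \<gamma> T \<longlongrightarrow> temp_c11 T) at_top"
proof -
  let ?\<nu> = "conv_nu \<alpha> d k \<gamma> T" and ?\<nu>\<^sub>0 = "temp_nu \<alpha> d k \<gamma> T"
  let ?A = "\<lambda>x. kummerM (- \<alpha>/2) (1/2) (- (x\<^sup>2))"
  let ?B = "\<lambda>x. kummerM (- \<alpha>/2 + 1/2) (3/2) (- (x\<^sup>2))"
  have A: "?A x > 0" and B: "?B x > 0" for x
    using assms by (intro kummerM_neg_pos; simp)+
  have nu0: "?\<nu>\<^sub>0 > 0" using temp_nu_root[OF assms] by simp
  note nu = conv_nu_tendsto[OF assms]
  have limA: "((\<lambda>h. ?A (?\<nu> h)) \<longlongrightarrow> ?A ?\<nu>\<^sub>0) at_top" and limB: "((\<lambda>h. ?B (?\<nu> h)) \<longlongrightarrow> ?B ?\<nu>\<^sub>0) at_top"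
    by (rule isCont_tendsto_compose[OF isCont_kummerM]; (intro tendsto_intros nu)?; simp)+
  have "((\<lambda>h. - 2 * sqrt d * T * ?A (?\<nu> h) /
        (k * (1 / h) * ?A (?\<nu> h) + 2 * sqrt d * ?\<nu> h * ?B (?\<nu> h)))
      \<longlongrightarrow> - 2 * sqrt d * T * ?A ?\<nu>\<^sub>0 / (k * 0 * ?A ?\<nu>\<^sub>0 + 2 * sqrt d * ?\<nu>\<^sub>0 * ?B ?\<nu>\<^sub>0)) at_top"
    using B[of ?\<nu>\<^sub>0] nu0 assms
    by (intro tendsto_intros tendsto_inverse_coefficient limA limB nu) auto
  moreover have "- 2 * sqrt d * T * ?A ?\<nu>\<^sub>0 / (k * 0 * ?A ?\<nu>\<^sub>0 + 2 * sqrt d * ?\<nu>\<^sub>0 * ?B ?\<nu>\<^sub>0)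
      = temp_c21 \<alpha> d k \<gamma> T"
    using assms by (simp add: temp_c21_def Let_def)
  moreover have "\<forall>\<^sub>F h in at_top. - 2 * sqrt d * T * ?A (?\<nu> h) /
        (k * (1 / h) * ?A (?\<nu> h) + 2 * sqrt d * ?\<nu> h * ?B (?\<nu> h)) = conv_c21 \<alpha> d k \<gamma> T h"
    using eventually_gt_at_top[of 0]
  proof eventually_elim
    case (elim h)
    have "k * ?A (?\<nu> h) + 2 * sqrt d * h * ?\<nu> h * ?B (?\<nu> h)
        = h * (k * (1 / h) * ?A (?\<nu> h) + 2 * sqrt d * ?\<nu> h * ?B (?\<nu> h))"
      using elim by (simp add: field_simps)
    moreover have "- 2 * h * sqrt d * T * ?A (?\<nu> h) = h * (- 2 * sqrt d * T * ?A (?\<nu> h))"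
      by simp
    ultimately show ?case
      using elim by (simp only: conv_c21_def Let_def) simp
  qed
  ultimately show c21: "(conv_c21 \<alpha> d k \<gamma> T \<longlongrightarrow> temp_c21 \<alpha> d k \<gamma> T) at_top"
    by (auto intro: Lim_transform_eventually)
  have "((\<lambda>h. - ?\<nu> h * ?B (?\<nu> h) / ?A (?\<nu> h) * conv_c21 \<alpha> d k \<gamma> T h)
      \<longlongrightarrow> - ?\<nu>\<^sub>0 * ?B ?\<nu>\<^sub>0 / ?A ?\<nu>\<^sub>0 * temp_c21 \<alpha> d k \<gamma> T) at_top"
    using A[of ?\<nu>\<^sub>0] by (intro tendsto_intros limA limB nu c21) auto
  moreover have "- ?\<nu>\<^sub>0 * ?B ?\<nu>\<^sub>0 / ?A ?\<nu>\<^sub>0 * temp_c21 \<alpha> d k \<gamma> T = temp_c11 T"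
    using A[of ?\<nu>\<^sub>0] B[of ?\<nu>\<^sub>0] nu0 by (simp add: temp_c21_def temp_c11_def Let_def)
  ultimately show "(conv_c11 \<alpha> d k \<gamma> T \<longlongrightarrow> temp_c11 T) at_top"
    unfolding conv_c11_def[abs_def] Let_def by simp
qed

theorem theorem4p1:
  fixes \<alpha> d k \<gamma> T :: real
  assumes "\<alpha> \<ge> 0" and "d > 0" and "k > 0" and "\<gamma> > 0" and "T > 0"
  shows "((\<lambda>h0. conv_nu \<alpha> d k \<gamma> T h0) \<longlongrightarrow> temp_nu \<alpha> d k \<gamma> T) at_top \<and>
    (\<forall>t>0. ((\<lambda>h0. conv_s \<alpha> d k \<gamma> T h0 t) \<longlongrightarrow> temp_s \<alpha> d k \<gamma> T t) at_top) \<and>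
    (\<forall>t>0. \<forall>x>0. ((\<lambda>h0. conv_Psi \<alpha> d k \<gamma> T h0 x t) \<longlongrightarrow> temp_Psi \<alpha> d k \<gamma> T x t) at_top)"
  unfolding conv_s_def temp_s_def conv_Psi_def temp_Psi_def Let_def
  by (intro conjI allI impI tendsto_intros conv_nu_tendsto conv_c11_tendsto conv_c21_tendsto assms)

end
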